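(* For each positive integer $n$, the lattice $\mathrm{Conv}(\mathbb{R}^n)$ satisfies the identity $((D_n)\vee z)\wedge y_1\wedge y_2$ but not the identity $D_n$, while the lattice $\mathrm{Conv}(\mathbb{R}^n)_{\geq\{0\}}$ satisfies the identity $D_n$ but, if $n>1$, not the identity $((D_{n-1})\vee z)\wedge y_1\wedge y_2$. Hence, in the chain of inclusions of varieties $$\mathbf V(\mathrm{Conv}(\mathbb{R}^0)_{\geq\{0\}})\subseteq\mathbf V(\mathrm{Conv}(\mathbb{R}^0))\subseteq\mathbf V(\mathrm{Conv}(\mathbb{R}^1)_{\geq\{0\}})\subseteq\mathbf V(\mathrm{Conv}(\mathbb{R}^1))\subseteq\dots\subseteq\mathbf V(\mathrm{Conv}(\mathbb{R}^n)_{\geq\{0\}})\subseteq\mathbf V(\mathrm{Conv}(\mathbb{R}^n))\subseteq\cdots$$ every inclusion is strict except the second one, $\mathbf V(\mathrm{Conv}(\mathbb{R}^0))\subseteq\mathbf V(\mathrm{Conv}(\mathbb{R}^1)_{\geq\{0\}})$, which is an equality.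
   Context: $\mathrm{Conv}(\mathbb{R}^n)$ is the lattice of all convex subsets of $\mathbb{R}^n$ (including $\emptyset$), with $x\wedge y=x\cap y$ and $x\vee y=$ the convex hull of $x\cup y$. $\mathrm{Conv}(\mathbb{R}^n)_{\geq\{0\}}$ is its sublattice of convex sets containing the origin. For a lattice $L$, $\mathbf V(L)$ is the variety of lattices generated by $L$, i.e. the class of all lattices satisfying every identity (in the binary operations $\wedge,\vee$) that holds in $L$. For a positive integer $n$, $D_n(x,y_1,\dots,y_{n+1})$ is the lattice relation $$x\wedge\Big(\bigvee_{i=1}^{n+1}y_i\Big)=\bigvee_{i=1}^{n+1}\Big(x\wedge\bigvee_{j\neq i}y_j\Big),$$ and a lattice satisfies the identity $D_n$ if this holds for all choices of elements $x,y_1,\dots,y_{n+1}$. The identity $((D_n)\vee z)\wedge y_1\wedge y_2$, in the $n+3$ variables $x,y_1,\dots,y_{n+1},z$, is obtained by applying the operation $((-)\vee z)\wedge y_1\wedge y_2$ to both sides of $D_n$: $$\Big(\Big(x\wedge\bigvee_i y_i\Big)\vee z\Big)\wedge y_1\wedge y_2=\Big(\bigvee_i\Big(x\wedge\bigvee_{j\neq i}y_j\Big)\vee z\Big)\wedge y_1\wedge y_2 .$$ *)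

theory Defs
  imports "HOL-Analysis.Analysis"
    "HOL-Analysis.Finite_Function_Topology"
    "HOL-Algebra.Lattice"
begin

text \<open>
  All spaces \<open>\<real>\<^sup>n\<close> (including \<open>n = 0\<close>) live in the real vector space of finitely supported
  sequences, so that \<open>n\<close> can be an ordinary natural number; coordinates are numbered from 0.
\<close>

definition Rn :: "nat \<Rightarrow> (nat \<Rightarrow>\<^sub>0 real) set" where
  "Rn n = {x. Poly_Mapping.keys x \<subseteq> {..<n}}"

definition Conv :: "nat \<Rightarrow> (nat \<Rightarrow>\<^sub>0 real) set gorder" where
  "Conv n = \<lparr> carrier = {S. S \<subseteq> Rn n \<and> convex S}, eq = (=), le = (\<subseteq>) \<rparr>"

definition Conv0 :: "nat \<Rightarrow> (nat \<Rightarrow>\<^sub>0 real) set gorder" where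
  "Conv0 n = (Conv n) \<lparr> carrier := {S \<in> carrier (Conv n). 0 \<in> S} \<rparr>"

text \<open>
  The library derives meet and join from the order. The following lemmas confirm that in both
  lattices they are intersection and convex hull of the union.
\<close>

lemma subspace_Rn: "subspace (Rn n)"
proof (rule subspaceI)
  fix x y :: "nat \<Rightarrow>\<^sub>0 real" and c :: real
  show "0 \<in> Rn n" by (simp add: Rn_def)
  show "x + y \<in> Rn n" if "x \<in> Rn n" "y \<in> Rn n"
    using that keys_add[of x y] by (auto simp: Rn_def)
  have "Poly_Mapping.keys (c *\<^sub>R x) \<subseteq> Poly_Mapping.keys x"
    by (auto simp: scaleR_poly_mapping_def in_keys_iff)
  then show "c *\<^sub>R x \<in> Rn n" if "x \<in> Rn n"
    using that by (auto simp: Rn_def)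
qed

lemma convex_hull_Un_in_Conv:
  assumes "S \<in> carrier (Conv n)" "T \<in> carrier (Conv n)"
  shows "convex hull (S \<union> T) \<in> carrier (Conv n)"
  using assms hull_minimal[of "S \<union> T" "Rn n" convex] subspace_imp_convex[OF subspace_Rn]
  by (auto simp: Conv_def)

lemma partial_order_inclusion: "partial_order \<lparr> carrier = A, eq = (=), le = (\<subseteq>) \<rparr>"
  by unfold_locales auto

lemma Conv0_eq: "Conv0 n = \<lparr> carrier = {S. S \<subseteq> Rn n \<and> convex S \<and> 0 \<in> S}, eq = (=), le = (\<subseteq>) \<rparr>"
  by (auto simp: Conv0_def Conv_def)

lemma partial_order_Conv: "partial_order (Conv n)"
  unfolding Conv_def by (rule partial_order_inclusion)

lemma partial_order_Conv0: "partial_order (Conv0 n)"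
  unfolding Conv0_eq by (rule partial_order_inclusion)

lemma least_Conv:
  assumes "S \<in> carrier (Conv n)" "T \<in> carrier (Conv n)"
  shows "least (Conv n) (convex hull (S \<union> T)) (Upper (Conv n) {S, T})"
proof (rule least_UpperI)
  show "x \<sqsubseteq>\<^bsub>Conv n\<^esub> convex hull (S \<union> T)" if "x \<in> {S, T}" for x
    using that hull_subset[of "S \<union> T" convex] by (auto simp: Conv_def)
  show "convex hull (S \<union> T) \<sqsubseteq>\<^bsub>Conv n\<^esub> y" if "y \<in> Upper (Conv n) {S, T}" for y
    using that assms hull_minimal[of "S \<union> T" y convex] by (simp add: Conv_def Upper_def)
qed (use assms convex_hull_Un_in_Conv in auto)

lemma greatest_Conv:
  assumes "S \<in> carrier (Conv n)" "T \<in> carrier (Conv n)"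
  shows "greatest (Conv n) (S \<inter> T) (Lower (Conv n) {S, T})"
  using assms by (intro greatest_LowerI) (auto simp: Conv_def Lower_def convex_Int)

lemma least_Conv0:
  assumes "S \<in> carrier (Conv0 n)" "T \<in> carrier (Conv0 n)"
  shows "least (Conv0 n) (convex hull (S \<union> T)) (Upper (Conv0 n) {S, T})"
proof (rule least_UpperI)
  have "0 \<in> convex hull (S \<union> T)"
    using assms hull_subset[of "S \<union> T" convex] by (auto simp: Conv0_def)
  then show "convex hull (S \<union> T) \<in> carrier (Conv0 n)"
    using assms convex_hull_Un_in_Conv[of S n T] by (simp add: Conv0_def)
  show "x \<sqsubseteq>\<^bsub>Conv0 n\<^esub> convex hull (S \<union> T)" if "x \<in> {S, T}" for x
    using that hull_subset[of "S \<union> T" convex] by (auto simp: Conv0_eq)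
  show "convex hull (S \<union> T) \<sqsubseteq>\<^bsub>Conv0 n\<^esub> y" if "y \<in> Upper (Conv0 n) {S, T}" for y
    using that assms hull_minimal[of "S \<union> T" y convex] by (simp add: Conv0_eq Upper_def)
qed (use assms in auto)

lemma greatest_Conv0:
  assumes "S \<in> carrier (Conv0 n)" "T \<in> carrier (Conv0 n)"
  shows "greatest (Conv0 n) (S \<inter> T) (Lower (Conv0 n) {S, T})"
  using assms by (intro greatest_LowerI) (auto simp: Conv0_eq Lower_def convex_Int)

lemma lattice_Conv: "lattice (Conv n)"
proof -
  interpret partial_order "Conv n"
    by (rule partial_order_Conv)
  show ?thesis
    by unfold_locales (rule exI, erule (1) least_Conv, rule exI, erule (1) greatest_Conv)
qed

lemma lattice_Conv0: "lattice (Conv0 n)"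
proof -
  interpret partial_order "Conv0 n"
    by (rule partial_order_Conv0)
  show ?thesis
    by unfold_locales (rule exI, erule (1) least_Conv0, rule exI, erule (1) greatest_Conv0)
qed

lemma join_eqI:
  assumes "partial_order L" "least L s (Upper L {x, y})"
  shows "x \<squnion>\<^bsub>L\<^esub> y = s"
  unfolding join_def sup_def
  using assms partial_order.least_unique[OF assms(1)] by (intro some_equality)

lemma meet_eqI:
  assumes "partial_order L" "greatest L i (Lower L {x, y})"
  shows "x \<sqinter>\<^bsub>L\<^esub> y = i"
  unfolding meet_def inf_def
  using assms partial_order.greatest_unique[OF assms(1)] by (intro some_equality)

lemma join_Conv:
  assumes "S \<in> carrier (Conv n)" "T \<in> carrier (Conv n)"
  shows "S \<squnion>\<^bsub>Conv n\<^esub> T = convex hull (S \<union> T)"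
  by (rule join_eqI[OF partial_order_Conv least_Conv[OF assms]])

lemma meet_Conv:
  assumes "S \<in> carrier (Conv n)" "T \<in> carrier (Conv n)"
  shows "S \<sqinter>\<^bsub>Conv n\<^esub> T = S \<inter> T"
  by (rule meet_eqI[OF partial_order_Conv greatest_Conv[OF assms]])

lemma join_Conv0:
  assumes "S \<in> carrier (Conv0 n)" "T \<in> carrier (Conv0 n)"
  shows "S \<squnion>\<^bsub>Conv0 n\<^esub> T = convex hull (S \<union> T)"
  by (rule join_eqI[OF partial_order_Conv0 least_Conv0[OF assms]])

lemma meet_Conv0:
  assumes "S \<in> carrier (Conv0 n)" "T \<in> carrier (Conv0 n)"
  shows "S \<sqinter>\<^bsub>Conv0 n\<^esub> T = S \<inter> T"
  by (rule meet_eqI[OF partial_order_Conv0 greatest_Conv0[OF assms]])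


datatype lterm = Var nat | Meet lterm lterm | Join lterm lterm

primrec eval :: "'a gorder \<Rightarrow> (nat \<Rightarrow> 'a) \<Rightarrow> lterm \<Rightarrow> 'a" where
  "eval L \<rho> (Var i) = \<rho> i"
| "eval L \<rho> (Meet s t) = eval L \<rho> s \<sqinter>\<^bsub>L\<^esub> eval L \<rho> t"
| "eval L \<rho> (Join s t) = eval L \<rho> s \<squnion>\<^bsub>L\<^esub> eval L \<rho> t"

definition satisfies :: "'a gorder \<Rightarrow> lterm \<times> lterm \<Rightarrow> bool" (infix "\<Turnstile>" 50) where
  "L \<Turnstile> e \<longleftrightarrow> (\<forall>\<rho>. range \<rho> \<subseteq> carrier L \<longrightarrow> eval L \<rho> (fst e) = eval L \<rho> (snd e))"

text \<open>
  The variety generated by \<open>L\<close> is a proper class; \<open>variety L :: 'b gorder set\<close> is its part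
  consisting of the lattices whose elements are taken from the type \<open>'b\<close>.
\<close>

definition variety :: "'a gorder \<Rightarrow> 'b gorder set" where
  "variety L = {M. lattice M \<and> (\<forall>e. L \<Turnstile> e \<longrightarrow> M \<Turnstile> e)}"

text \<open>
  Variables: \<open>x\<close> is \<open>Var 0\<close>, \<open>y\<^sub>i\<close> is \<open>Var i\<close> for \<open>1 \<le> i \<le> n + 1\<close>, and \<open>z\<close> is \<open>Var (n + 2)\<close>.
  Joins are only ever taken over nonempty lists, the equation for \<open>[]\<close> being a dummy.
\<close>

fun Joins :: "lterm list \<Rightarrow> lterm" where
  "Joins [] = undefined"
| "Joins [t] = t"
| "Joins (t # u # ts) = Join t (Joins (u # ts))"

definition D :: "nat \<Rightarrow> lterm \<times> lterm" where
  "D n =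
    (Meet (Var 0) (Joins (map Var [1..<n + 2])),
     Joins (map (\<lambda>i. Meet (Var 0) (Joins (map Var (filter (\<lambda>j. j \<noteq> i) [1..<n + 2])))) [1..<n + 2]))"

definition Dz :: "nat \<Rightarrow> lterm \<times> lterm" where
  "Dz n = map_prod (\<lambda>t. Meet (Meet (Join t (Var (n + 2))) (Var 1)) (Var 2))
                   (\<lambda>t. Meet (Meet (Join t (Var (n + 2))) (Var 1)) (Var 2)) (D n)"

end

theory Submission
  imports Defs
begin

text \<open>
  If \<open>p\<close> lies in enough of the \<open>y\<^sub>i\<close>, then a linear dependence of the vectors \<open>q\<^sub>i - p\<close> turns
  a convex combination of the \<open>n + 1\<close> points \<open>q\<^sub>i \<in> y\<^sub>i\<close> into one of \<open>p\<close> and all but one of the \<open>q\<^sub>i\<close>.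
  With \<open>p = 0\<close> this gives \<open>D\<^sub>n\<close> in \<open>Conv(\<real>\<^sup>n)\<close> above \<open>{0}\<close>, and with \<open>p \<in> y\<^sub>1 \<inter> y\<^sub>2\<close> it gives
  \<open>((D\<^sub>n) \<or> z) \<and> y\<^sub>1 \<and> y\<^sub>2\<close> in \<open>Conv(\<real>\<^sup>n)\<close>. A simplex and its barycenter refute \<open>D\<^sub>n\<close>, and
  the segments from \<open>0\<close> to the basis vectors, each enlarged by the point \<open>- e\<^sub>0\<close>, refute the other
  identity. Passing to cones over \<open>\<real>\<^sup>n \<times> {1}\<close> embeds \<open>Conv(\<real>\<^sup>n)\<close> into \<open>Conv(\<real>\<^sup>n\<^sup>+\<^sup>1)\<close> above \<open>{0}\<close>,
  and the lattice of intervals containing \<open>0\<close> is separated by membership of points.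
\<close>

section \<open>Homomorphisms and identities\<close>

definition lattice_hom :: "'a gorder \<Rightarrow> 'b gorder \<Rightarrow> ('a \<Rightarrow> 'b) set" where
  "lattice_hom L M = {h \<in> carrier L \<rightarrow> carrier M. \<forall>x\<in>carrier L. \<forall>y\<in>carrier L.
     h (x \<sqinter>\<^bsub>L\<^esub> y) = h x \<sqinter>\<^bsub>M\<^esub> h y \<and> h (x \<squnion>\<^bsub>L\<^esub> y) = h x \<squnion>\<^bsub>M\<^esub> h y}"

lemma eval_closed:
  assumes "lattice L" "range \<rho> \<subseteq> carrier L"
  shows "eval L \<rho> t \<in> carrier L"
proof -
  interpret lattice L by fact
  show ?thesis
    using assms(2) by (induction t) auto
qed

lemma eval_lattice_hom:
  assumes "lattice L" "h \<in> lattice_hom L M" "range \<rho> \<subseteq> carrier L"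
  shows "h (eval L \<rho> t) = eval M (h \<circ> \<rho>) t"
  using assms eval_closed[OF assms(1,3)] by (induction t) (auto simp: lattice_hom_def)

text \<open>An assignment refuting \<open>e\<close> in \<open>L\<close> produces two distinct
  values; a homomorphism that keeps them apart carries the refutation to \<open>M\<close>.
  Separation of points amounts to an embedding of \<open>L\<close> into a power of \<open>M\<close>,
  and this form avoids building the power.\<close>

lemma satisfies_if_separated:
  assumes L: "lattice L" and M: "M \<Turnstile> e"
    and sep: "\<And>x y. \<lbrakk>x \<in> carrier L; y \<in> carrier L; x \<noteq> y\<rbrakk> \<Longrightarrow> \<exists>h\<in>lattice_hom L M. h x \<noteq> h y"
  shows "L \<Turnstile> e"
  unfolding satisfies_def
proof (intro allI impI, rule ccontr)
  fix \<rho>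
  assume \<rho>: "range \<rho> \<subseteq> carrier L" and ne: "eval L \<rho> (fst e) \<noteq> eval L \<rho> (snd e)"
  obtain h where h: "h \<in> lattice_hom L M" "h (eval L \<rho> (fst e)) \<noteq> h (eval L \<rho> (snd e))"
    using sep[OF eval_closed[OF L \<rho>] eval_closed[OF L \<rho>] ne] by blast
  have "range (h \<circ> \<rho>) \<subseteq> carrier M"
    using h(1) \<rho> by (auto simp: lattice_hom_def)
  then show False
    using M h(2) by (simp add: eval_lattice_hom[OF L h(1) \<rho>] satisfies_def)
qed

lemma satisfies_if_embedded:
  assumes "lattice L" "M \<Turnstile> e" "h \<in> lattice_hom L M" "inj_on h (carrier L)"
  shows "L \<Turnstile> e"
  using assms by (intro satisfies_if_separated[of L M e]) (auto dest: inj_onD)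

lemma variety_mono:
  assumes "\<And>e. M \<Turnstile> e \<Longrightarrow> L \<Turnstile> e"
  shows "variety L \<subseteq> variety M"
  using assms by (auto simp: variety_def)

text \<open>The witness for strictness is \<open>M\<close> itself, which is why both varieties are
  taken over the element type of \<open>M\<close>.\<close>

lemma variety_strict_mono:
  fixes L M :: "'a gorder"
  assumes "(variety L :: 'a gorder set) \<subseteq> variety M" "lattice M" "L \<Turnstile> e" "\<not> M \<Turnstile> e"
  shows "(variety L :: 'a gorder set) \<subset> variety M"
proof -
  have "M \<in> variety M" "M \<notin> variety L"
    using assms(2-4) unfolding variety_def by blast+
  with assms(1) show ?thesis by blast
qed

section \<open>Lattices of convex sets\<close>

lemma carrier_Conv: "S \<in> carrier (Conv n) \<longleftrightarrow> S \<subseteq> Rn n \<and> convex S"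
  by (simp add: Conv_def)

lemma carrier_Conv0: "S \<in> carrier (Conv0 n) \<longleftrightarrow> S \<in> carrier (Conv n) \<and> 0 \<in> S"
  by (simp add: Conv0_def)

text \<open>Meet and join are given by the same set operations in both lattices. Hence every
  evaluation in \<open>Conv0 n\<close> can be computed in \<open>Conv n\<close>, and the term
  computations are done only once.\<close>

lemma Conv0_embeds_Conv: "(\<lambda>S. S) \<in> lattice_hom (Conv0 n) (Conv n)"
  by (auto simp: lattice_hom_def join_Conv join_Conv0 meet_Conv meet_Conv0)
     (auto simp: carrier_Conv0 join_Conv meet_Conv)

lemma eval_Conv0:
  assumes "range \<rho> \<subseteq> carrier (Conv0 n)"
  shows "eval (Conv0 n) \<rho> t = eval (Conv n) \<rho> t"
  using eval_lattice_hom[OF lattice_Conv0 Conv0_embeds_Conv assms] by (simp add: comp_def)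

lemma satisfies_Conv0:
  "Conv0 n \<Turnstile> e \<longleftrightarrow>
   (\<forall>\<rho>. range \<rho> \<subseteq> carrier (Conv0 n) \<longrightarrow> eval (Conv n) \<rho> (fst e) = eval (Conv n) \<rho> (snd e))"
  by (auto simp: satisfies_def eval_Conv0)

text \<open>Nested hulls collapse to one: replacing a part of a union by its hull does not change
  the hull of the union.\<close>

lemma eval_Joins_Conv:
  assumes "ts \<noteq> []" "range \<rho> \<subseteq> carrier (Conv n)"
  shows "eval (Conv n) \<rho> (Joins ts) = convex hull (\<Union>t\<in>set ts. eval (Conv n) \<rho> t)"
  using assms
proof (induction ts rule: Joins.induct)
  case (2 t)
  then show ?case
    using eval_closed[OF lattice_Conv 2(2), of t] by (simp add: carrier_Conv hull_same)
next
  case (3 t u ts)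
  have "eval (Conv n) \<rho> (Joins (t # u # ts)) =
      convex hull (eval (Conv n) \<rho> t \<union> eval (Conv n) \<rho> (Joins (u # ts)))"
    using eval_closed[OF lattice_Conv 3(3)] by (simp add: join_Conv)
  also have "eval (Conv n) \<rho> (Joins (u # ts)) = convex hull (\<Union>v\<in>set (u # ts). eval (Conv n) \<rho> v)"
    using 3 by simp
  finally show ?case
    by (simp flip: hull_Un_right)
qed simp

section \<open>The two sides of the identities as convex sets\<close>

lemma set_upt_indices: "set [1..<m + 2] = {1..m+1}"
  by auto

lemma eval_fst_D_Conv:
  assumes "range \<rho> \<subseteq> carrier (Conv n)"
  shows "eval (Conv n) \<rho> (fst (D m)) = \<rho> 0 \<inter> convex hull (\<Union>i\<in>{1..m+1}. \<rho> i)"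
proof -
  have "eval (Conv n) \<rho> (Joins (map Var [1..<m + 2])) = convex hull (\<Union>i\<in>{1..m+1}. \<rho> i)"
    by (subst eval_Joins_Conv[OF _ assms])
      (simp, simp only: set_map set_upt_indices image_image eval.simps)
  moreover have "\<rho> 0 \<in> carrier (Conv n)"
    using assms by auto
  ultimately show ?thesis
    using meet_Conv[OF _ eval_closed[OF lattice_Conv assms], of "\<rho> 0"]
    by (metis D_def eval.simps(1,2) fst_conv)
qed

lemma eval_meet_joins_except_Conv:
  assumes "range \<rho> \<subseteq> carrier (Conv n)" "m \<ge> 1"
  shows "eval (Conv n) \<rho> (Meet (Var 0) (Joins (map Var (filter (\<lambda>j. j \<noteq> i) [1..<m + 2]))))
    = \<rho> 0 \<inter> convex hull (\<Union>j\<in>{1..m+1}-{i}. \<rho> j)"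
proof -
  have set_filter: "set (filter (\<lambda>j. j \<noteq> i) [1..<m + 2]) = {1..m+1} - {i}"
    unfolding set_filter set_upt_indices by blast
  \<comment> \<open>An index different from \<open>i\<close>, available because \<open>m\<close> is
    at least 1; it keeps the join nonempty, so that the dummy value of \<open>Joins []\<close> never
    enters.\<close>
  moreover have "(if i = 1 then 2 else 1) \<in> {1..m+1} - {i}"
    using assms(2) by simp
  ultimately have "filter (\<lambda>j. j \<noteq> i) [1..<m + 2] \<noteq> []"
    by (metis empty_iff empty_set)
  then have "eval (Conv n) \<rho> (Joins (map Var (filter (\<lambda>j. j \<noteq> i) [1..<m + 2])))
      = convex hull (\<Union>j\<in>{1..m+1}-{i}. \<rho> j)"
    by (subst eval_Joins_Conv[OF _ assms(1)])
      (simp, simp only: set_map set_filter image_image eval.simps)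
  moreover have "\<rho> 0 \<in> carrier (Conv n)"
    using assms(1) by auto
  ultimately show ?thesis
    using meet_Conv[OF _ eval_closed[OF lattice_Conv assms(1)], of "\<rho> 0"]
    by (metis eval.simps(1,2))
qed

lemma eval_snd_D_Conv:
  assumes "range \<rho> \<subseteq> carrier (Conv n)" "m \<ge> 1"
  shows "eval (Conv n) \<rho> (snd (D m)) =
         convex hull (\<Union>i\<in>{1..m+1}. \<rho> 0 \<inter> convex hull (\<Union>j\<in>{1..m+1}-{i}. \<rho> j))"
proof -
  define t where
    "t = (\<lambda>i. Meet (Var 0) (Joins (map Var (filter (\<lambda>j. j \<noteq> i) [1..<m + 2]))))"
  have "eval (Conv n) \<rho> (snd (D m)) =
      convex hull (\<Union>u\<in>set (map t [1..<m + 2]). eval (Conv n) \<rho> u)"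
    unfolding D_def snd_conv t_def by (rule eval_Joins_Conv) (use assms(1) in simp_all)
  also have "\<dots> = convex hull (\<Union>i\<in>{1..m+1}. eval (Conv n) \<rho> (t i))"
    by (simp only: set_map set_upt_indices image_image)
  finally show ?thesis
    by (simp only: t_def eval_meet_joins_except_Conv[OF assms])
qed

lemma eval_Dz_Conv:
  assumes "range \<rho> \<subseteq> carrier (Conv n)"
  shows "eval (Conv n) \<rho> (fst (Dz m)) =
           convex hull (eval (Conv n) \<rho> (fst (D m)) \<union> \<rho> (m + 2)) \<inter> \<rho> 1 \<inter> \<rho> 2"
    and "eval (Conv n) \<rho> (snd (Dz m)) =
           convex hull (eval (Conv n) \<rho> (snd (D m)) \<union> \<rho> (m + 2)) \<inter> \<rho> 1 \<inter> \<rho> 2"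
proof -
  have "\<rho> i \<in> carrier (Conv n)" for i
    using assms by auto
  moreover have "S \<inter> T \<in> carrier (Conv n)" if "S \<in> carrier (Conv n)" "T \<in> carrier (Conv n)" for S T
    using that by (auto simp: carrier_Conv convex_Int)
  ultimately show
    "eval (Conv n) \<rho> (fst (Dz m)) =
       convex hull (eval (Conv n) \<rho> (fst (D m)) \<union> \<rho> (m + 2)) \<inter> \<rho> 1 \<inter> \<rho> 2"
    "eval (Conv n) \<rho> (snd (Dz m)) =
       convex hull (eval (Conv n) \<rho> (snd (D m)) \<union> \<rho> (m + 2)) \<inter> \<rho> 1 \<inter> \<rho> 2"
    by (simp_all add: Dz_def eval_closed[OF lattice_Conv assms] join_Conv meet_Conv
        convex_hull_Un_in_Conv)
qed

text \<open>This half of the identity is pure order theory and holds in every lattice; only the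
  opposite inclusion depends on the dimension.\<close>

lemma eval_D_snd_subset_fst:
  assumes "range \<rho> \<subseteq> carrier (Conv n)" "m \<ge> 1"
  shows "eval (Conv n) \<rho> (snd (D m)) \<subseteq> eval (Conv n) \<rho> (fst (D m))"
  unfolding eval_fst_D_Conv[OF assms(1)] eval_snd_D_Conv[OF assms]
proof (rule hull_minimal)
  show "(\<Union>i\<in>{1..m+1}. \<rho> 0 \<inter> convex hull (\<Union>j\<in>{1..m+1}-{i}. \<rho> j)) \<subseteq>
        \<rho> 0 \<inter> convex hull (\<Union>i\<in>{1..m+1}. \<rho> i)"
    by (intro UN_least Int_mono order_refl hull_mono) auto
  show "convex (\<rho> 0 \<inter> convex hull (\<Union>i\<in>{1..m+1}. \<rho> i))"
    using assms(1) carrier_Conv by (intro convex_Int) auto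
qed

section \<open>Dropping a point from a convex combination\<close>

lemma lookup_scaleR: "Poly_Mapping.lookup (c *\<^sub>R x) i = c *\<^sub>R Poly_Mapping.lookup x i"
proof -
  have "finite {i. c *\<^sub>R Poly_Mapping.lookup x i \<noteq> 0}"
    by (rule finite_subset[OF _ finite_keys[of x]]) (auto simp: in_keys_iff)
  then show ?thesis
    by (simp add: scaleR_poly_mapping_def Abs_poly_mapping_inverse)
qed

lemma linear_lookup: "linear (\<lambda>x :: 'a \<Rightarrow>\<^sub>0 'b::real_vector. Poly_Mapping.lookup x i)"
  by (rule linearI) (simp_all add: lookup_add lookup_scaleR)

lemma mem_Rn_iff: "x \<in> Rn n \<longleftrightarrow> (\<forall>i\<ge>n. Poly_Mapping.lookup x i = 0)"
  by (auto simp: Rn_def in_keys_iff subset_iff) (meson not_le)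

lemma single_mem_Rn: "i < n \<Longrightarrow> Poly_Mapping.single i c \<in> Rn n"
  by (simp add: mem_Rn_iff lookup_single when_def)

lemma Rn_subset_span: "Rn n \<subseteq> span ((\<lambda>i. Poly_Mapping.single i 1) ` {..<n})"
proof
  fix x assume x: "x \<in> Rn n"
  have "x = (\<Sum>i<n. Poly_Mapping.lookup x i *\<^sub>R Poly_Mapping.single i 1)"
    using x by (intro poly_mapping_eqI)
      (auto simp: lookup_sum lookup_scaleR lookup_single when_def mem_Rn_iff if_distrib cong: if_cong)
  then show "x \<in> span ((\<lambda>i. Poly_Mapping.single i 1) ` {..<n})"
    by (metis (no_types, lifting) imageI span_base span_scale span_sum)
qed

text \<open>Dependence is stated for indexed families because points chosen from different sets may
  coincide. A repeated vector gives the coefficients 1 and -1; otherwise the image has more than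
  \<open>n\<close> elements inside a span of \<open>n\<close> vectors.\<close>

lemma linear_dependence_Rn:
  assumes "finite I" "card I > n" "\<And>i. i \<in> I \<Longrightarrow> v i \<in> Rn n"
  obtains c :: "'i \<Rightarrow> real" where "\<exists>i\<in>I. c i \<noteq> 0" "(\<Sum>i\<in>I. c i *\<^sub>R v i) = 0"
proof (cases "inj_on v I")
  case True
  have "dependent (v ` I)"
  proof (rule ccontr)
    assume "independent (v ` I)"
    moreover have "v ` I \<subseteq> span ((\<lambda>i. Poly_Mapping.single i 1) ` {..<n})"
      using assms(3) Rn_subset_span by blast
    ultimately have "card (v ` I) \<le> card ((\<lambda>i::nat. Poly_Mapping.single i (1::real)) ` {..<n})"
      by (intro independent_span_bound[THEN conjunct2]) auto
    also have "\<dots> \<le> n"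
      using card_image_le[of "{..<n}"] by simp
    finally show False
      using assms(2) True by (simp add: card_image)
  qed
  then obtain u w where "w \<in> v ` I" "u w \<noteq> 0" "(\<Sum>w\<in>v ` I. u w *\<^sub>R w) = 0"
    using assms(1) by (auto simp: dependent_finite)
  then show thesis
    using True that[of "u \<circ> v"] by (auto simp: sum.reindex)
next
  case False
  then obtain i j where ij: "i \<in> I" "j \<in> I" "i \<noteq> j" "v i = v j"
    by (auto simp: inj_on_def)
  define c :: "'i \<Rightarrow> real" where "c = (\<lambda>k. if k = i then 1 else if k = j then -1 else 0)"
  have "(\<Sum>k\<in>I. c k *\<^sub>R v k) = (\<Sum>k\<in>{i, j}. c k *\<^sub>R v k)"
    using assms(1) ij by (intro sum.mono_neutral_right) (auto simp: c_def)
  also have "\<dots> = 0"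
    using ij by (simp add: c_def)
  finally show thesis
    using ij by (intro that[of c]) (auto simp: c_def)
qed

text \<open>This is the exchange argument of Caratheodory's theorem. The coefficients
  \<open>l\<close> are shifted along a dependence of the vectors \<open>q i - p\<close> until one of
  them vanishes. The shift may change the total weight, and \<open>p\<close> makes up the
  difference.\<close>

lemma convex_combination_drop:
  assumes I: "finite I" "card I > n"
    and q: "\<And>i. i \<in> I \<Longrightarrow> q i \<in> Rn n" and p: "p \<in> Rn n"
    and l: "\<And>i. i \<in> I \<Longrightarrow> 0 \<le> l i" "sum l I = (1::real)"
  obtains k where "k \<in> I" "(\<Sum>i\<in>I. l i *\<^sub>R q i) \<in> convex hull insert p (q ` (I - {k}))"
proof -
  have qp: "q i - p \<in> Rn n" if "i \<in> I" for i
    using q[OF that] p subspace_Rn subspace_diff by blast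
  obtain c0 where c0: "\<exists>i\<in>I. c0 i \<noteq> 0" "(\<Sum>i\<in>I. c0 i *\<^sub>R (q i - p)) = 0"
    by (rule linear_dependence_Rn[of I n "\<lambda>i. q i - p"]) (use I qp in auto)
  \<comment> \<open>The sign is chosen so that the coefficient sum, which later determines the
    weight of \<open>p\<close>, is nonnegative.\<close>
  define c where "c = (\<lambda>i. if sum c0 I \<ge> 0 then c0 i else - c0 i)"
  have c: "\<exists>i\<in>I. c i \<noteq> 0" "(\<Sum>i\<in>I. c i *\<^sub>R (q i - p)) = 0" "sum c I \<ge> 0"
    using c0 by (cases "sum c0 I \<ge> 0"; simp add: c_def sum_negf)+
  define P where "P = {i \<in> I. c i > 0}"
  \<comment> \<open>Without a positive coefficient, all of them would be nonpositive with
    nonnegative sum, hence zero.\<close>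
  have "P \<noteq> {}"
  proof
    assume "P = {}"
    then have nonneg: "\<And>i. i \<in> I \<Longrightarrow> 0 \<le> - c i"
      by (fastforce simp: P_def)
    then have "(\<Sum>i\<in>I. - c i) = 0"
      using c(3) sum_nonneg[of I "\<lambda>i. - c i"] by (simp add: sum_negf)
    then have "\<forall>i\<in>I. - c i = 0"
      using sum_nonneg_eq_0_iff[OF I(1), of "\<lambda>i. - c i"] nonneg by blast
    then show False
      using c(1) by simp
  qed
  moreover have "finite P"
    using I by (simp add: P_def)
  \<comment> \<open>The smallest ratio is the largest shift that keeps all coefficients nonnegative,
    and it annihilates the coefficient at \<open>k\<close>.\<close>
  ultimately obtain k where k: "k \<in> P" "\<And>i. i \<in> P \<Longrightarrow> l k / c k \<le> l i / c i"
    using ex_is_arg_min_if_finite[of P "\<lambda>i. l i / c i"] by (auto simp: is_arg_min_linorder)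
  define t where "t = l k / c k"
  have t: "t \<ge> 0" "k \<in> I" "l k - t * c k = 0"
    using k(1) l(1) by (auto simp: t_def P_def)
  have mu: "l i - t * c i \<ge> 0" if "i \<in> I" for i
  proof (cases "c i > 0")
    case True
    then show ?thesis
      using k(2)[of i] that by (simp add: P_def t_def field_simps)
  next
    case False
    then have "t * c i \<le> 0"
      using t(1) by (simp add: mult_nonneg_nonpos)
    then show ?thesis
      using l(1)[OF that] by linarith
  qed
  \<comment> \<open>The slot freed at \<open>k\<close> is reused for \<open>p\<close>, with exactly
    the weight removed from the other points, so the total stays 1.\<close>
  define w where "w = (\<lambda>i. l i - t * c i)(k := t * sum c I)"
  define r where "r = q(k := p)"
  have "sum w I = w k + sum w (I - {k})" "(\<Sum>i\<in>I. l i - t * c i) = (\<Sum>i\<in>I - {k}. l i - t * c i)"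
    using sum.remove[OF I(1) t(2), of w] sum.remove[OF I(1) t(2), of "\<lambda>i. l i - t * c i"] t(3)
    by simp_all
  moreover have "sum w (I - {k}) = (\<Sum>i\<in>I - {k}. l i - t * c i)"
    by (intro sum.cong) (auto simp: w_def)
  ultimately have w1: "sum w I = 1"
    using l(2) by (simp add: sum_subtractf sum_distrib_left w_def)
  have w0: "w i \<ge> 0" if "i \<in> I" for i
    using mu[OF that] c(3) t(1) by (simp add: w_def)
  have "(\<Sum>i\<in>I. w i *\<^sub>R r i) = (t * sum c I) *\<^sub>R p + (\<Sum>i\<in>I - {k}. w i *\<^sub>R r i)"
    using sum.remove[OF I(1) t(2), of "\<lambda>i. w i *\<^sub>R r i"] by (simp add: w_def r_def)
  also have "(\<Sum>i\<in>I - {k}. w i *\<^sub>R r i) = (\<Sum>i\<in>I - {k}. (l i - t * c i) *\<^sub>R q i)"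
    by (intro sum.cong) (auto simp: w_def r_def)
  also have "\<dots> = (\<Sum>i\<in>I. (l i - t * c i) *\<^sub>R q i)"
    using sum.remove[OF I(1) t(2), of "\<lambda>i. (l i - t * c i) *\<^sub>R q i"] t(3) by simp
  also have "\<dots> = (\<Sum>i\<in>I. l i *\<^sub>R q i) - t *\<^sub>R (\<Sum>i\<in>I. c i *\<^sub>R q i)"
    by (simp add: scaleR_diff_left sum_subtractf scaleR_sum_right)
  also have "(\<Sum>i\<in>I. c i *\<^sub>R q i) = sum c I *\<^sub>R p"
    using c(2) by (simp add: scaleR_diff_right sum_subtractf scaleR_sum_left)
  finally have eq: "(\<Sum>i\<in>I. l i *\<^sub>R q i) = (\<Sum>i\<in>I. w i *\<^sub>R r i)"
    by simp
  have "(\<Sum>i\<in>I. w i *\<^sub>R r i) \<in> convex hull insert p (q ` (I - {k}))"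
    using I(1) w1 w0 by (intro convex_sum) (auto simp: r_def intro!: hull_inc)
  then show thesis
    by (intro that[OF t(2)]) (simp only: eq)
qed

text \<open>The condition on \<open>p\<close> says that it lies in at least two of the sets. So
  whichever index \<open>k\<close> is dropped, \<open>p\<close> still belongs to one of the
  remaining sets and may replace the point \<open>q k\<close>.\<close>

lemma convex_hull_UN_drop:
  assumes I: "finite I" "card I > n"
    and y: "\<And>i. i \<in> I \<Longrightarrow> y i \<in> carrier (Conv n)"
    and p: "\<And>i. i \<in> I \<Longrightarrow> \<exists>j\<in>I - {i}. p \<in> y j"
    and a: "a \<in> convex hull (\<Union>i\<in>I. y i)"
  shows "\<exists>k\<in>I. a \<in> convex hull (\<Union>j\<in>I - {k}. y j)"
\<comment> \<open>An empty set can itself be dropped. Otherwise a point of the hull is a convex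
  combination of one point from each set.\<close>
proof (cases "\<exists>k\<in>I. y k = {}")
  case True
  then obtain k where "k \<in> I" "y k = {}"
    by blast
  moreover from this have "(\<Union>i\<in>I. y i) = (\<Union>j\<in>I - {k}. y j)"
    by blast
  ultimately show ?thesis
    using a by auto
next
  case False
  have "\<forall>i\<in>I. convex (y i) \<and> y i \<noteq> {}"
    using False y by (auto simp: carrier_Conv)
  then obtain l q where lq: "\<forall>i\<in>I. 0 \<le> l i" "sum l I = 1" "\<forall>i\<in>I. q i \<in> y i"
    and a_eq: "a = (\<Sum>i\<in>I. l i *\<^sub>R q i)"
    using a convex_hull_finite_union[OF I(1), of y] by auto
  have qR: "\<And>i. i \<in> I \<Longrightarrow> q i \<in> Rn n"
    using lq(3) y by (auto simp: carrier_Conv)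
  have "I \<noteq> {}"
    using I by auto
  then have "p \<in> Rn n"
    using p y by (fastforce simp: carrier_Conv)
  obtain k where k: "k \<in> I" "a \<in> convex hull insert p (q ` (I - {k}))"
    unfolding a_eq
    by (rule convex_combination_drop[OF I qR \<open>p \<in> Rn n\<close> _ lq(2)]) (use lq(1) in auto)
  have "insert p (q ` (I - {k})) \<subseteq> (\<Union>j\<in>I - {k}. y j)"
    using p[OF k(1)] lq(3) by auto
  then show ?thesis
    using k hull_mono by blast
qed

section \<open>The identities that hold\<close>

lemma eval_D_fst_subset_snd:
  assumes "range \<rho> \<subseteq> carrier (Conv n)" "n \<ge> 1"
    and "\<And>i. i \<in> {1..n+1} \<Longrightarrow> \<exists>j\<in>{1..n+1} - {i}. p \<in> \<rho> j"
  shows "eval (Conv n) \<rho> (fst (D n)) \<subseteq> eval (Conv n) \<rho> (snd (D n))"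
  unfolding eval_fst_D_Conv[OF assms(1)] eval_snd_D_Conv[OF assms(1,2)]
proof
  fix a
  assume a: "a \<in> \<rho> 0 \<inter> convex hull (\<Union>i\<in>{1..n+1}. \<rho> i)"
  have "\<exists>k\<in>{1..n+1}. a \<in> convex hull (\<Union>j\<in>{1..n+1} - {k}. \<rho> j)"
    by (rule convex_hull_UN_drop[of _ n _ p]) (use assms a in auto)
  with a have "a \<in> (\<Union>k\<in>{1..n+1}. \<rho> 0 \<inter> convex hull (\<Union>j\<in>{1..n+1} - {k}. \<rho> j))"
    by blast
  then show "a \<in> convex hull (\<Union>k\<in>{1..n+1}. \<rho> 0 \<inter> convex hull (\<Union>j\<in>{1..n+1} - {k}. \<rho> j))"
    by (rule hull_inc)
qed

lemma Conv0_satisfies_D: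
  assumes "n \<ge> 1"
  shows "Conv0 n \<Turnstile> D n"
  unfolding satisfies_Conv0
proof (intro allI impI equalityI)
  fix \<rho> :: "nat \<Rightarrow> (nat \<Rightarrow>\<^sub>0 real) set"
  assume \<rho>: "range \<rho> \<subseteq> carrier (Conv0 n)"
  then have \<rho>': "range \<rho> \<subseteq> carrier (Conv n)" "\<And>i. 0 \<in> \<rho> i"
    unfolding image_subset_iff carrier_Conv0 by blast+
  show "eval (Conv n) \<rho> (snd (D n)) \<subseteq> eval (Conv n) \<rho> (fst (D n))"
    by (rule eval_D_snd_subset_fst[OF \<rho>'(1) assms])
  have "\<exists>j\<in>{1..n+1} - {i}. 0 \<in> \<rho> j" for i
    using assms \<rho>'(2) by (intro bexI[of _ "if i = 1 then 2 else 1"]) auto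
  then show "eval (Conv n) \<rho> (fst (D n)) \<subseteq> eval (Conv n) \<rho> (snd (D n))"
    by (intro eval_D_fst_subset_snd[OF \<rho>'(1) assms])
qed

text \<open>Any point of the left side lies in both \<open>\<rho> 1\<close> and
  \<open>\<rho> 2\<close> and can serve as the common point \<open>p\<close>. Thus, unless the left
  side is empty, the nontrivial inclusion of \<open>D n\<close> already holds for this very
  assignment, and joining with \<open>z\<close> preserves it.\<close>

lemma Conv_satisfies_Dz:
  assumes "n \<ge> 1"
  shows "Conv n \<Turnstile> Dz n"
  unfolding satisfies_def
proof (intro allI impI equalityI)
  fix \<rho> :: "nat \<Rightarrow> (nat \<Rightarrow>\<^sub>0 real) set"
  assume \<rho>: "range \<rho> \<subseteq> carrier (Conv n)"
  show "eval (Conv n) \<rho> (snd (Dz n)) \<subseteq> eval (Conv n) \<rho> (fst (Dz n))"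
    unfolding eval_Dz_Conv[OF \<rho>]
    by (intro Int_mono hull_mono Un_mono order_refl eval_D_snd_subset_fst[OF \<rho> assms])
  show "eval (Conv n) \<rho> (fst (Dz n)) \<subseteq> eval (Conv n) \<rho> (snd (Dz n))"
    unfolding eval_Dz_Conv[OF \<rho>]
  proof
    fix p
    assume p: "p \<in> convex hull (eval (Conv n) \<rho> (fst (D n)) \<union> \<rho> (n + 2)) \<inter> \<rho> 1 \<inter> \<rho> 2"
    then have "\<exists>j\<in>{1..n+1} - {i}. p \<in> \<rho> j" for i
      using assms by (intro bexI[of _ "if i = 1 then 2 else 1"]) auto
    then have "eval (Conv n) \<rho> (fst (D n)) \<subseteq> eval (Conv n) \<rho> (snd (D n))"
      by (intro eval_D_fst_subset_snd[OF \<rho> assms])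
    then have "convex hull (eval (Conv n) \<rho> (fst (D n)) \<union> \<rho> (n + 2)) \<subseteq>
               convex hull (eval (Conv n) \<rho> (snd (D n)) \<union> \<rho> (n + 2))"
      by (intro hull_mono Un_mono order_refl)
    with p show "p \<in> convex hull (eval (Conv n) \<rho> (snd (D n)) \<union> \<rho> (n + 2)) \<inter> \<rho> 1 \<inter> \<rho> 2"
      by blast
  qed
qed

section \<open>The identities that fail\<close>

lemma not_Conv_satisfies_D:
  assumes "n \<ge> 1"
  shows "\<not> Conv n \<Turnstile> D n"
proof
  assume D: "Conv n \<Turnstile> D n"
  \<comment> \<open>The vertices are the basis vectors \<open>v 1\<close>, ..., \<open>v n\<close>
    and the origin \<open>v (n + 1)\<close>; \<open>b\<close> is their barycenter.\<close>
  define v :: "nat \<Rightarrow> nat \<Rightarrow>\<^sub>0 real" where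
    "v = (\<lambda>i. if i \<le> n then Poly_Mapping.single (i - 1) 1 else 0)"
  define b where "b = (\<Sum>i\<in>{1..n+1}. (1 / (n + 1)) *\<^sub>R v i)"
  define \<rho> where "\<rho> = (\<lambda>i::nat. {if i = 0 then b else v i})"
  have v: "v i \<in> Rn n" for i
    using assms subspace_0[OF subspace_Rn] by (simp add: v_def single_mem_Rn)
  then have "b \<in> Rn n"
    unfolding b_def by (intro subspace_sum subspace_scale subspace_Rn)
  with v have \<rho>: "range \<rho> \<subseteq> carrier (Conv n)"
    by (auto simp: \<rho>_def carrier_Conv)
  have lookup_v: "Poly_Mapping.lookup (v i) k = (if i = Suc k then 1 else 0)"
    if "k < n" "i \<ge> 1" for i k
    using that by (auto simp: v_def lookup_single when_def)
  have lookup_b: "Poly_Mapping.lookup b k = 1 / (n + 1)" if "k < n" for k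
  proof -
    have "Poly_Mapping.lookup b k = (\<Sum>i\<in>{1..n+1}. if i = Suc k then 1 / (n + 1) else 0)"
      unfolding b_def lookup_sum lookup_scaleR using that
      by (intro sum.cong) (auto simp: lookup_v)
    also have "\<dots> = 1 / (n + 1)"
      using that by (subst sum.delta) auto
    finally show ?thesis .
  qed
  have "b \<in> convex hull (\<Union>i\<in>{1..n+1}. \<rho> i)"
    unfolding b_def by (rule convex_sum) (auto simp: \<rho>_def intro!: hull_inc)
  then have "b \<in> eval (Conv n) \<rho> (fst (D n))"
    unfolding eval_fst_D_Conv[OF \<rho>] by (simp add: \<rho>_def)
  then have "b \<in> eval (Conv n) \<rho> (snd (D n))"
    using D \<rho> by (auto simp: satisfies_def)
  \<comment> \<open>The barycenter lies on no facet. On the facet opposite the origin the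
    coordinates sum to 1, while those of \<open>b\<close> sum to n/(n+1); every other facet lies in
    a coordinate hyperplane. As \<open>x\<close> is the single point \<open>b\<close>, the right
    side is empty.\<close>
  moreover have "b \<notin> convex hull (\<Union>j\<in>{1..n+1} - {i}. \<rho> j)" if i: "i \<in> {1..n+1}" for i
  proof (cases "i = n + 1")
    case True
    define f where "f = (\<lambda>x. \<Sum>k<n. Poly_Mapping.lookup x k :: real)"
    have "linear f"
      unfolding f_def by (intro linear_compose_sum ballI linear_lookup)
    have "f (v j) = 1" if "j \<in> {1..n}" for j
    proof -
      have "f (v j) = (\<Sum>k<n. if k = j - 1 then 1 else 0)"
        unfolding f_def using that by (intro sum.cong) (auto simp: lookup_v)
      also have "\<dots> = 1"
        using that by (subst sum.delta) auto
      finally show ?thesis .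
    qed
    then have "convex hull (\<Union>j\<in>{1..n+1} - {i}. \<rho> j) \<subseteq> f -` {1}"
      using True by (intro hull_minimal convex_linear_vimage \<open>linear f\<close>) (auto simp: \<rho>_def)
    moreover have "f b \<noteq> 1"
      by (simp add: f_def lookup_b field_simps)
    ultimately show ?thesis
      by blast
  next
    case False
    then have "convex hull (\<Union>j\<in>{1..n+1} - {i}. \<rho> j) \<subseteq> (\<lambda>x. Poly_Mapping.lookup x (i - 1)) -` {0}"
      using i by (intro hull_minimal convex_linear_vimage linear_lookup)
        (auto simp: \<rho>_def lookup_v)
    moreover have "Poly_Mapping.lookup b (i - 1) \<noteq> 0"
    proof -
      have "i - 1 < n"
        using i False by auto
      then show ?thesis
        by (simp add: lookup_b)
    qed
    ultimately show ?thesis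
      by blast
  qed
  ultimately show False
    unfolding eval_snd_D_Conv[OF \<rho> assms] by (simp add: \<rho>_def)
qed

lemma not_Conv0_satisfies_Dz:
  assumes "m \<ge> 1"
  shows "\<not> Conv0 (m + 1) \<Turnstile> Dz m"
proof
  assume Dz: "Conv0 (m + 1) \<Turnstile> Dz m"
  define n where "n = m + 1"
  define e :: "nat \<Rightarrow> nat \<Rightarrow>\<^sub>0 real" where "e = (\<lambda>i. Poly_Mapping.single i 1)"
  \<comment> \<open>This point has no positive coordinate, so adding it to every \<open>y j\<close>
    leaves the half-spaces used below intact.\<close>
  define p where "p = - e 0"
  define a where "a = (\<Sum>i\<in>{1..n}. (1 / n) *\<^sub>R e (i - 1))"
  \<comment> \<open>Chosen to make \<open>p\<close> the midpoint of \<open>a\<close> and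
    \<open>b\<close>.\<close>
  define b where "b = 2 *\<^sub>R p - a"
  define \<rho> where "\<rho> = (\<lambda>i. convex hull
    (if i = 0 then {0, a} else if i \<le> n then {0, e (i - 1), p} else {0, b}))"
  have e: "e i \<in> Rn n" if "i < n" for i
    using that by (simp add: e_def single_mem_Rn)
  have "n \<ge> 2"
    using assms by (simp add: n_def)
  then have p: "p \<in> Rn n"
    using e subspace_neg[OF subspace_Rn] by (simp add: p_def)
  have a: "a \<in> Rn n"
    unfolding a_def by (intro subspace_sum subspace_scale subspace_Rn e) auto
  have b: "b \<in> Rn n"
    unfolding b_def by (intro subspace_diff subspace_scale subspace_Rn p a)
  have "\<rho> i \<in> carrier (Conv0 n)" for i
  proof -
    have "0 \<in> Rn n"
      by (rule subspace_0[OF subspace_Rn])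
    then have "\<rho> i \<subseteq> Rn n"
      unfolding \<rho>_def by (intro hull_minimal subspace_imp_convex subspace_Rn) (auto simp: e p a b)
    then show ?thesis
      by (auto simp: carrier_Conv0 carrier_Conv \<rho>_def intro: hull_inc)
  qed
  then have \<rho>0: "range \<rho> \<subseteq> carrier (Conv0 n)" and \<rho>: "range \<rho> \<subseteq> carrier (Conv n)"
    by (auto simp: carrier_Conv0)
  have lookup_e: "Poly_Mapping.lookup (e i) k = (if i = k then 1 else 0)" for i k
    by (simp add: e_def lookup_single when_def)
  have lookup_a: "Poly_Mapping.lookup a k = 1 / n" if "k < n" for k
  proof -
    have "Poly_Mapping.lookup a k = (\<Sum>i\<in>{1..n}. if i = Suc k then 1 / n else 0)"
      unfolding a_def lookup_sum lookup_scaleR by (intro sum.cong) (auto simp: lookup_e)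
    also have "\<dots> = 1 / n"
      using that by (subst sum.delta) auto
    finally show ?thesis .
  qed
  have lookup_p: "Poly_Mapping.lookup p k = (if k = 0 then -1 else 0)" for k
    by (simp add: p_def lookup_e)
  have fst_D: "eval (Conv n) \<rho> (fst (D m)) = \<rho> 0 \<inter> convex hull (\<Union>i\<in>{1..n}. \<rho> i)"
    and snd_D: "eval (Conv n) \<rho> (snd (D m)) =
      convex hull (\<Union>i\<in>{1..n}. \<rho> 0 \<inter> convex hull (\<Union>j\<in>{1..n} - {i}. \<rho> j))"
    using eval_fst_D_Conv[OF \<rho>] eval_snd_D_Conv[OF \<rho> assms] by (simp_all add: n_def)
  have "e (i - 1) \<in> \<rho> i" if "i \<in> {1..n}" for i
    using that by (auto simp: \<rho>_def intro!: hull_inc)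
  then have "a \<in> convex hull (\<Union>i\<in>{1..n}. \<rho> i)"
    unfolding a_def using \<open>n \<ge> 2\<close> by (intro convex_sum) (auto intro!: hull_inc)
  then have "a \<in> eval (Conv n) \<rho> (fst (D m))"
    unfolding fst_D by (simp add: \<rho>_def hull_inc)
  moreover have "b \<in> \<rho> (m + 2)"
    by (simp add: \<rho>_def n_def hull_inc)
  ultimately have
    "(1/2) *\<^sub>R a + (1/2) *\<^sub>R b \<in> convex hull (eval (Conv n) \<rho> (fst (D m)) \<union> \<rho> (m + 2))"
    by (intro convexD[OF convex_convex_hull]) (auto intro!: hull_inc)
  moreover have "(1/2) *\<^sub>R a + (1/2) *\<^sub>R b = p"
    by (simp add: b_def scaleR_diff_right)
  moreover have "p \<in> \<rho> 1" "p \<in> \<rho> 2"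
    using \<open>n \<ge> 2\<close> by (auto simp: \<rho>_def intro!: hull_inc)
  ultimately have "p \<in> eval (Conv n) \<rho> (fst (Dz m))"
    unfolding eval_Dz_Conv[OF \<rho>] by simp
  then have "p \<in> eval (Conv n) \<rho> (snd (Dz m))"
    using Dz \<rho>0 unfolding satisfies_Conv0 n_def by auto
  then have p_mem: "p \<in> convex hull (eval (Conv n) \<rho> (snd (D m)) \<union> \<rho> (m + 2))"
    unfolding eval_Dz_Conv[OF \<rho>] by simp
  \<comment> \<open>Without \<open>y i\<close>, coordinate \<open>i - 1\<close> is nonpositive on
    the whole join, whereas it is positive on every nonzero multiple of \<open>a\<close> in the
    segment \<open>x\<close>. So the right side of \<open>D m\<close> shrinks to the origin.\<close>
  have "\<rho> 0 \<inter> convex hull (\<Union>j\<in>{1..n} - {i}. \<rho> j) \<subseteq> {0}" if i: "i \<in> {1..n}" for i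
  proof
    fix x assume x: "x \<in> \<rho> 0 \<inter> convex hull (\<Union>j\<in>{1..n} - {i}. \<rho> j)"
    then obtain s where s: "s \<ge> 0" "x = s *\<^sub>R a"
      by (auto simp: \<rho>_def convex_hull_2)
    let ?H = "(\<lambda>x. Poly_Mapping.lookup x (i - 1)) -` {..0::real}"
    have "convex ?H"
      by (intro convex_linear_vimage linear_lookup convex_real_interval)
    then have "\<rho> j \<subseteq> ?H" if "j \<in> {1..n} - {i}" for j
      using that i unfolding \<rho>_def by (intro hull_minimal) (auto simp: lookup_e lookup_p)
    then have "convex hull (\<Union>j\<in>{1..n} - {i}. \<rho> j) \<subseteq> ?H"
      using \<open>convex ?H\<close> by (intro hull_minimal UN_least)
    then have "x \<in> ?H"
      using x by blast
    moreover have "i - 1 < n"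
      using i by auto
    ultimately have "s * (1 / n) \<le> 0"
      by (simp add: s(2) lookup_scaleR lookup_a)
    then have "s = 0"
      using s(1) \<open>n \<ge> 2\<close> by (auto simp: field_simps mult_le_0_iff)
    then show "x \<in> {0}"
      using s(2) by simp
  qed
  then have "eval (Conv n) \<rho> (snd (D m)) \<subseteq> {0}"
    unfolding snd_D by (intro hull_minimal UN_least convex_singleton)
  moreover have "\<rho> (m + 2) = convex hull {0, b}"
    by (simp add: \<rho>_def n_def)
  ultimately have "p \<in> convex hull {0, b}"
    using p_mem hull_minimal[of "eval (Conv n) \<rho> (snd (D m)) \<union> \<rho> (m + 2)" "convex hull {0, b}" convex]
    by (auto intro: hull_inc)
  then obtain s where s: "p = s *\<^sub>R b"
    by (auto simp: convex_hull_2)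
  \<comment> \<open>Coordinate 1 exists because \<open>n\<close> is at least 2; it vanishes at
    \<open>p\<close> but not at \<open>b\<close>, so \<open>p\<close> is not on the segment from the
    origin to \<open>b\<close>.\<close>
  have "Poly_Mapping.lookup b 1 = - (1 / n)"
    using lookup_a[of 1] \<open>n \<ge> 2\<close> by (simp add: b_def lookup_minus lookup_scaleR lookup_p)
  then have "s = 0"
    using arg_cong[OF s, of "\<lambda>x. Poly_Mapping.lookup x 1"] \<open>n \<ge> 2\<close>
    by (simp add: lookup_scaleR lookup_p)
  then show False
    using arg_cong[OF s, of "\<lambda>x. Poly_Mapping.lookup x 0"] by (simp add: lookup_p)
qed

section \<open>The chain of varieties\<close>

lemma Conv0_satisfies_if_Conv: "Conv n \<Turnstile> e \<Longrightarrow> Conv0 n \<Turnstile> e"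
  by (rule satisfies_if_embedded[OF lattice_Conv0 _ Conv0_embeds_Conv]) auto

section \<open>Cones raise the dimension by one\<close>

text \<open>The cone over \<open>S \<times> {1}\<close> with apex \<open>0\<close>; coordinate \<open>n\<close> is the height.\<close>

definition cone_over :: "nat \<Rightarrow> (nat \<Rightarrow>\<^sub>0 real) set \<Rightarrow> (nat \<Rightarrow>\<^sub>0 real) set" where
  "cone_over n S = {v. v = 0 \<or> 0 < Poly_Mapping.lookup v n \<and>
     inverse (Poly_Mapping.lookup v n) *\<^sub>R v - Poly_Mapping.single n 1 \<in> S}"

lemma zero_mem_cone_over [simp]: "0 \<in> cone_over n S"
  by (simp add: cone_over_def)

lemma cone_over_mono: "S \<subseteq> T \<Longrightarrow> cone_over n S \<subseteq> cone_over n T"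
  by (auto simp: cone_over_def)

lemma cone_over_Int: "cone_over n (S \<inter> T) = cone_over n S \<inter> cone_over n T"
  by (auto simp: cone_over_def)

text \<open>Each slice of the cone at positive height is a scaled copy of \<open>S\<close>; the
  slice at height 1 recovers \<open>S\<close> and gives injectivity.\<close>

lemma scaleR_mem_cone_over_iff:
  assumes "s \<in> Rn n" "t > 0"
  shows "t *\<^sub>R (s + Poly_Mapping.single n 1) \<in> cone_over n S \<longleftrightarrow> s \<in> S"
proof -
  have "Poly_Mapping.lookup (t *\<^sub>R (s + Poly_Mapping.single n 1)) n = t"
    using assms by (simp add: lookup_scaleR lookup_add mem_Rn_iff)
  moreover from this have "t *\<^sub>R (s + Poly_Mapping.single n 1) \<noteq> 0"
    using assms(2) by (metis lookup_zero less_irrefl)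
  ultimately show ?thesis
    using assms by (simp add: cone_over_def)
qed

lemma cone_over_subset_Rn:
  assumes "S \<subseteq> Rn n"
  shows "cone_over n S \<subseteq> Rn (n + 1)"
proof
  fix v assume v: "v \<in> cone_over n S"
  show "v \<in> Rn (n + 1)"
    unfolding mem_Rn_iff
  proof (intro allI impI)
    fix i assume i: "i \<ge> n + 1"
    show "Poly_Mapping.lookup v i = 0"
    proof (cases "v = 0")
      case False
      with v assms have v': "0 < Poly_Mapping.lookup v n"
          "inverse (Poly_Mapping.lookup v n) *\<^sub>R v - Poly_Mapping.single n 1 \<in> Rn n"
        by (auto simp: cone_over_def)
      then have "Poly_Mapping.lookup
          (inverse (Poly_Mapping.lookup v n) *\<^sub>R v - Poly_Mapping.single n 1) i = 0"
        using i by (simp only: mem_Rn_iff)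
      then show ?thesis
        using v'(1) i by (simp add: lookup_minus lookup_scaleR lookup_single when_def)
    qed simp
  qed
qed

lemma convex_cone_over:
  assumes "convex S"
  shows "convex (cone_over n S)"
proof (rule convexI)
  have scale: "u *\<^sub>R v \<in> cone_over n S" if "v \<in> cone_over n S" "u \<ge> 0" for u v
  proof (cases "u = 0")
    case False
    then have "inverse (u * Poly_Mapping.lookup v n) *\<^sub>R u *\<^sub>R v = inverse (Poly_Mapping.lookup v n) *\<^sub>R v"
      by (simp add: field_simps)
    then show ?thesis
      using that False by (auto simp: cone_over_def lookup_scaleR simp del: scaleR_scaleR)
  qed simp
  have add: "v + w \<in> cone_over n S" if vw: "v \<in> cone_over n S" "w \<in> cone_over n S" for v w
  proof (cases "v = 0 \<or> w = 0")
    case False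
    let ?e = "Poly_Mapping.single n (1::real)"
    let ?a = "Poly_Mapping.lookup v n" and ?b = "Poly_Mapping.lookup w n"
    have ab: "?a > 0" "?b > 0" and mem: "inverse ?a *\<^sub>R v - ?e \<in> S" "inverse ?b *\<^sub>R w - ?e \<in> S"
      using False vw by (auto simp: cone_over_def)
    have cancel: "?a / (?a + ?b) * inverse ?a = inverse (?a + ?b)"
        "?b / (?a + ?b) * inverse ?b = inverse (?a + ?b)"
      using ab by (simp_all add: divide_inverse)
    \<comment> \<open>The slice point of \<open>v + w\<close> is the average of the slice points of
      \<open>v\<close> and \<open>w\<close>, weighted by their heights.\<close>
    have "(?a / (?a + ?b)) *\<^sub>R (inverse ?a *\<^sub>R v - ?e) + (?b / (?a + ?b)) *\<^sub>R (inverse ?b *\<^sub>R w - ?e) \<in> S"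
      using ab by (intro convexD[OF assms mem]) (auto simp flip: add_divide_distrib)
    also have "(?a / (?a + ?b)) *\<^sub>R (inverse ?a *\<^sub>R v - ?e) + (?b / (?a + ?b)) *\<^sub>R (inverse ?b *\<^sub>R w - ?e)
        = inverse (?a + ?b) *\<^sub>R (v + w) - (?a / (?a + ?b) + ?b / (?a + ?b)) *\<^sub>R ?e"
      unfolding scaleR_diff_right scaleR_scaleR cancel scaleR_add_left scaleR_add_right
      by (rule add_diff_add[symmetric])
    also have "?a / (?a + ?b) + ?b / (?a + ?b) = 1"
      using ab by (simp flip: add_divide_distrib)
    finally show ?thesis
      using ab by (simp add: cone_over_def lookup_add)
  qed (use vw in auto)
  show "u *\<^sub>R v + t *\<^sub>R w \<in> cone_over n S"
    if "v \<in> cone_over n S" "w \<in> cone_over n S" "0 \<le> u" "0 \<le> t" for u t v w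
    using that by (intro add scale)
qed

lemma cone_over_convex_hull_Un:
  assumes "S \<subseteq> Rn n" "T \<subseteq> Rn n"
  shows "cone_over n (convex hull (S \<union> T)) = convex hull (cone_over n S \<union> cone_over n T)"
proof
  let ?e = "Poly_Mapping.single n (1::real)" and ?H = "convex hull (cone_over n S \<union> cone_over n T)"
  show "?H \<subseteq> cone_over n (convex hull (S \<union> T))"
    by (intro hull_minimal Un_least cone_over_mono convex_cone_over convex_convex_hull)
       (auto intro: hull_inc)
  show "cone_over n (convex hull (S \<union> T)) \<subseteq> ?H"
  proof
    fix v assume v: "v \<in> cone_over n (convex hull (S \<union> T))"
    show "v \<in> ?H"
    proof (cases "v = 0")
      case True
      then show ?thesis by (simp add: hull_inc)
    next
      case False
      define t where "t = Poly_Mapping.lookup v n"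
      have t: "t > 0" and s: "inverse t *\<^sub>R v - ?e \<in> convex hull (S \<union> T)"
        using v False by (auto simp: cone_over_def t_def)
      \<comment> \<open>At the fixed height \<open>t\<close>, the points whose lift lies in
        \<open>?H\<close> form a convex set containing \<open>S\<close> and \<open>T\<close>, hence
        also the hull of their union.\<close>
      have "convex {s. t *\<^sub>R (s + ?e) \<in> ?H}"
      proof (rule convexI, safe)
        fix x y and u w :: real
        assume xy: "t *\<^sub>R (x + ?e) \<in> ?H" "t *\<^sub>R (y + ?e) \<in> ?H" and uw: "0 \<le> u" "0 \<le> w" "u + w = 1"
        have "t *\<^sub>R (u *\<^sub>R x + w *\<^sub>R y + (u + w) *\<^sub>R ?e) = u *\<^sub>R (t *\<^sub>R (x + ?e)) + w *\<^sub>R (t *\<^sub>R (y + ?e))"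
          by (simp only: scaleR_add_left scaleR_add_right scaleR_scaleR ac_simps)
        with convexD[OF convex_convex_hull xy uw] uw(3)
        show "t *\<^sub>R (u *\<^sub>R x + w *\<^sub>R y + ?e) \<in> ?H"
          by simp
      qed
      moreover have "S \<union> T \<subseteq> {s. t *\<^sub>R (s + ?e) \<in> ?H}"
        using assms t by (auto simp: scaleR_mem_cone_over_iff intro!: hull_inc)
      ultimately have "t *\<^sub>R (inverse t *\<^sub>R v - ?e + ?e) \<in> ?H"
        using s hull_minimal[of "S \<union> T" _ convex] by blast
      then show ?thesis
        using t by simp
    qed
  qed
qed

lemma cone_over_lattice_hom: "cone_over n \<in> lattice_hom (Conv n) (Conv0 (n + 1))"
proof -
  have mem: "cone_over n S \<in> carrier (Conv0 (n + 1))" if "S \<in> carrier (Conv n)" for S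
    using that cone_over_subset_Rn[of S n] convex_cone_over[of S n]
    by (auto simp: carrier_Conv0 carrier_Conv)
  have "cone_over n (S \<sqinter>\<^bsub>Conv n\<^esub> T) = cone_over n S \<sqinter>\<^bsub>Conv0 (n + 1)\<^esub> cone_over n T \<and>
      cone_over n (S \<squnion>\<^bsub>Conv n\<^esub> T) = cone_over n S \<squnion>\<^bsub>Conv0 (n + 1)\<^esub> cone_over n T"
    if "S \<in> carrier (Conv n)" "T \<in> carrier (Conv n)" for S T
    unfolding meet_Conv[OF that] join_Conv[OF that] meet_Conv0[OF that[THEN mem]]
      join_Conv0[OF that[THEN mem]]
    using that by (simp add: cone_over_Int cone_over_convex_hull_Un carrier_Conv)
  with mem show ?thesis
    by (auto simp: lattice_hom_def)
qed

lemma inj_on_cone_over: "inj_on (cone_over n) (carrier (Conv n))"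
proof (rule inj_onI)
  fix S T assume ST: "S \<in> carrier (Conv n)" "T \<in> carrier (Conv n)" "cone_over n S = cone_over n T"
  have "s \<in> S \<longleftrightarrow> s \<in> T" if "s \<in> Rn n" for s
    using scaleR_mem_cone_over_iff[OF that zero_less_one] ST(3) by metis
  with ST(1,2) show "S = T"
    by (auto simp: carrier_Conv)
qed

lemma Conv_satisfies_if_Conv0: "Conv0 (n + 1) \<Turnstile> e \<Longrightarrow> Conv n \<Turnstile> e"
  by (rule satisfies_if_embedded[OF lattice_Conv _ cone_over_lattice_hom inj_on_cone_over])

section \<open>Intervals around the origin\<close>

lemma convex_hull_Un_Conv0_1:
  assumes "S \<in> carrier (Conv0 1)" "T \<in> carrier (Conv0 1)"
  shows "convex hull (S \<union> T) = S \<union> T"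
proof (rule antisym[OF _ hull_subset], rule subsetI)
  fix p assume p: "p \<in> convex hull (S \<union> T)"
  \<comment> \<open>In dimension 1, two sets suffice for dropping one: with the origin as common
    point, every point of the join already lies in one of the two sets.\<close>
  have "\<exists>k\<in>UNIV. p \<in> convex hull (\<Union>j\<in>UNIV - {k}. if j then S else T)"
  proof (rule convex_hull_UN_drop[of _ 1 _ 0])
    show "\<exists>j\<in>UNIV - {i}. 0 \<in> (if j then S else T)" for i
      using assms by (intro bexI[of _ "\<not> i"]) (auto simp: carrier_Conv0)
  qed (use assms p in \<open>auto simp: carrier_Conv0 UNIV_bool Un_commute\<close>)
  then obtain k where "p \<in> convex hull (\<Union>j\<in>UNIV - {k}. if j then S else T)"
    by blast
  then have "p \<in> convex hull S \<or> p \<in> convex hull T"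
    by (cases k) (auto simp: UNIV_bool)
  then show "p \<in> S \<union> T"
    using assms by (simp add: carrier_Conv0 carrier_Conv hull_same)
qed

lemma Conv0_1_satisfies_if_Conv_0:
  assumes "Conv 0 \<Turnstile> e"
  shows "Conv0 1 \<Turnstile> e"
proof (rule satisfies_if_separated[OF lattice_Conv0 assms])
  fix S T assume "S \<in> carrier (Conv0 1)" "T \<in> carrier (Conv0 1)" "S \<noteq> T"
  then obtain p where p: "p \<in> S \<longleftrightarrow> p \<notin> T"
    by blast
  \<comment> \<open>\<open>Conv 0\<close> has just the two elements \<open>{}\<close> and
    \<open>{0}\<close>, so \<open>h\<close> is membership of \<open>p\<close>. It preserves joins
    because joins in \<open>Conv0 1\<close> are unions.\<close>
  define h where "h = (\<lambda>S. if p \<in> S then {0 :: nat \<Rightarrow>\<^sub>0 real} else {})"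
  have h: "h S \<in> carrier (Conv 0)" for S
    using subspace_0[OF subspace_Rn] by (simp add: h_def carrier_Conv)
  have "h (S \<sqinter>\<^bsub>Conv0 1\<^esub> T) = h S \<sqinter>\<^bsub>Conv 0\<^esub> h T \<and> h (S \<squnion>\<^bsub>Conv0 1\<^esub> T) = h S \<squnion>\<^bsub>Conv 0\<^esub> h T"
    if "S \<in> carrier (Conv0 1)" "T \<in> carrier (Conv0 1)" for S T
    unfolding meet_Conv0[OF that] join_Conv0[OF that] meet_Conv[OF h h] join_Conv[OF h h]
      convex_hull_Un_Conv0_1[OF that] by (simp add: h_def)
  with h have "h \<in> lattice_hom (Conv0 1) (Conv 0)"
    by (auto simp: lattice_hom_def)
  moreover have "h S \<noteq> h T"
    using p by (auto simp: h_def)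
  ultimately show "\<exists>h\<in>lattice_hom (Conv0 1) (Conv 0). h S \<noteq> h T"
    by blast
qed

lemma Conv0_0_satisfies_trivial: "Conv0 0 \<Turnstile> (Var 0, Var 1)"
proof -
  have "S = {0}" if "S \<in> carrier (Conv0 0)" for S
    using that by (auto simp: carrier_Conv0 carrier_Conv Rn_def subset_iff)
  then show ?thesis
    unfolding satisfies_def image_subset_iff by (metis UNIV_I eval.simps(1) fst_conv snd_conv)
qed

lemma not_Conv_satisfies_trivial: "\<not> Conv n \<Turnstile> (Var 0, Var 1)"
proof -
  define \<rho> where "\<rho> = (\<lambda>i::nat. if i = 0 then {} else {0 :: nat \<Rightarrow>\<^sub>0 real})"
  have "range \<rho> \<subseteq> carrier (Conv n)"
    using subspace_0[OF subspace_Rn] by (auto simp: \<rho>_def carrier_Conv)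
  moreover have "\<rho> 0 \<noteq> \<rho> 1"
    by (simp add: \<rho>_def)
  ultimately show ?thesis
    by (auto simp: satisfies_def)
qed

section \<open>Inclusions, the one equality, and strictness\<close>

lemma variety_Conv0_subset: "variety (Conv0 n) \<subseteq> variety (Conv n)"
  by (intro variety_mono Conv0_satisfies_if_Conv)

lemma variety_Conv_subset: "variety (Conv n) \<subseteq> variety (Conv0 (n + 1))"
  by (intro variety_mono Conv_satisfies_if_Conv0)

lemma variety_Conv_0: "variety (Conv 0) = variety (Conv0 1)"
  using variety_Conv_subset[of 0] variety_mono[OF Conv0_1_satisfies_if_Conv_0] by auto

lemma variety_Conv0_psubset:
  "(variety (Conv0 n) :: (nat \<Rightarrow>\<^sub>0 real) set gorder set) \<subset> variety (Conv n)"
\<comment> \<open>In dimension 0 the identity x = y takes over the role of \<open>D n\<close>: it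
  holds in the one-element lattice \<open>Conv0 0\<close> and fails in
  \<open>Conv 0\<close>.\<close>
proof (cases "n = 0")
  case True
  then show ?thesis
    using variety_strict_mono[OF variety_Conv0_subset lattice_Conv Conv0_0_satisfies_trivial
        not_Conv_satisfies_trivial] by simp
next
  case False
  then have "n \<ge> 1"
    by simp
  then show ?thesis
    by (intro variety_strict_mono[OF variety_Conv0_subset lattice_Conv Conv0_satisfies_D
          not_Conv_satisfies_D])
qed

lemma variety_Conv_psubset:
  assumes "n \<ge> 1"
  shows "(variety (Conv n) :: (nat \<Rightarrow>\<^sub>0 real) set gorder set) \<subset> variety (Conv0 (n + 1))"
  by (rule variety_strict_mono[OF variety_Conv_subset lattice_Conv0 Conv_satisfies_Dz[OF assms]
        not_Conv0_satisfies_Dz[OF assms]])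

(* Inclusions and the equality of varieties are asserted for lattices over an arbitrary type 'b.
   Non-inclusion only needs a witness over one type, here a type containing all Conv n and Conv0 n. *)
theorem theorem8:
  shows
    "(\<forall>n\<ge>1. Conv n \<Turnstile> Dz n \<and> \<not> Conv n \<Turnstile> D n \<and> Conv0 n \<Turnstile> D n \<and>
             (n > 1 \<longrightarrow> \<not> Conv0 n \<Turnstile> Dz (n - 1))) \<and>
     (\<forall>n. (variety (Conv0 n) :: 'b gorder set) \<subseteq> variety (Conv n)) \<and>
     (\<forall>n. (variety (Conv n) :: 'b gorder set) \<subseteq> variety (Conv0 (n + 1))) \<and>
     (\<forall>n. (variety (Conv0 n) :: (nat \<Rightarrow>\<^sub>0 real) set gorder set) \<subset> variety (Conv n)) \<and>
     (\<forall>n\<ge>1. (variety (Conv n) :: (nat \<Rightarrow>\<^sub>0 real) set gorder set) \<subset> variety (Conv0 (n + 1))) \<and>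
     (variety (Conv 0) :: 'b gorder set) = variety (Conv0 1)"
  using variety_Conv0_subset variety_Conv_subset variety_Conv0_psubset variety_Conv_psubset
    variety_Conv_0 Conv_satisfies_Dz not_Conv_satisfies_D Conv0_satisfies_D
    not_Conv0_satisfies_Dz[of "n - 1" for n]
  by (intro conjI allI impI) simp_all

end
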